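(* Let $e\ge1$, $e'=e+1$, let $\lambda$ be a partition of $n$ and let $\rho\in\{0,1,\dots,e\}$. Let $\lambda^+$ be obtained from $(\lambda,\rho)$ by the box construction and let $\lambda_+$ be obtained from $(\lambda,\rho)$ by the abacus construction (adding a rightmost runner with $k(\lambda)+N_0-N$ beads). Then $\lambda_+=\lambda^+$.
   Context: **Residues.** $I=\mathbb Z/e'\mathbb Z$ is identified with $\{0,\dots,e\}$. Nodes of $\lambda$ are $(r,c)$ with $1\le c\le\lambda_r$; the residue of $(r,c)$ is $c-r+\rho\bmod e'$. An $i$-node is a node of residue $i$. **Box construction $\lambda^+$.** A strip is a nonempty finite sequence of nodes $(A_1,\dots,A_k)$ of $\lambda$ with residues in $\{0,1\}$ such that if $A_j=(r,c)$ has residue $0$ then $A_{j+1}=(r,c+1)$, and if $A_j=(r,c)$ has residue $1$ then $A_{j+1}=(r+1,c)$; it starts with the residue of $A_1$; it is maximal if it is not part of a longer strip. Simultaneously for all maximal strips: if the strip starts with $0$, then for each of its $0$-nodes a new node is inserted immediately to the right, pushing the nodes to the right of it in its row one step right; if the strip starts with $1$, then for each of its $0$-nodes a new node is inserted immediately above it, pushing it and all nodes below it in its column one step down. Explicitly, an old node $(r,c)$ moves to $(r+a,c+b)$, where $a$ is the number of $0$-nodes $(r',c)$, $r'\le r$, in maximal strips starting with $1$, and $b$ the number of $0$-nodes $(r,c')$, $c'<c$, in maximal strips starting with $0$; the new node attached to a $0$-node is immediately right of (resp. above) the new place of that $0$-node if its strip starts with $0$ (resp. $1$). $\lambda^+$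 is the sequence of row lengths of the resulting set of boxes. **Abacus.** Put $\beta_i=\lambda_i+\rho-i$ for $i\ge1$ and write $\beta_i=a_ie'+b_i$ with $0\le b_i<e'$. Choose a negative integer $N$ with $\rho-Ne'\ge\ell(\lambda)$, where $\ell(\lambda)$ is the number of nonzero parts. $\mathrm{Ab}(\lambda,\rho)$ has runners $0,\dots,e$ from left to right and levels $N,N+1,\dots$ increasing downwards, with a bead on runner $b_i$ at level $a_i$ for each $i$ with $a_i\ge N$ (levels below $N$ in number are regarded as full). The position on runner $b$ at level $a$ of an abacus with $p$ runners has number $ap+b$. An abacus with $p$ runners, levels $\ge N$, and beads at positions $x_1>\dots>x_M$ corresponds to the charge $\rho^*$ with $\rho^*-Np=M$ and the partition with parts $x_j-\rho^*+j$ ($1\le j\le M$). Let $t=\ell(\lambda)$ and $N_0=a_{t+1}+1$ if $b_{t+1}=e'-1$, $N_0=a_{t+1}$ otherwise. Let $k(\lambda)=\#\{i\ge1: i\equiv\rho\bmod e',\ \lambda_{i+1}>0\}$. **Abacus construction $\lambda_+$.** Insert a new rightmost runner in $\mathrm{Ab}(\lambda,\rho)$ and put $k(\lambda)+N_0-N$ beads on it from the top, i.e. at the positions $j(e'+1)+e'$ for $N\le j\le N_0+k(\lambda)-1$ of the new abacus with $e'+1$ runners (old beads keep runner and level). The new abacus corresponds to the partition $\lambda_+$ and a charge $\rho_+$. *)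

theory Defs
  imports "HOL-Library.Sublist" "HOL-Number_Theory.Cong"
begin

text \<open>A partition is the function of its parts \<open>lam 1 \<ge> lam 2 \<ge> \<dots>\<close>. Parts are indexed from 1;
  the unused value \<open>lam 0\<close> is normalised to 0, so that equality of partitions is equality
  of functions.\<close>

definition is_partition_of :: "(nat \<Rightarrow> nat) \<Rightarrow> nat \<Rightarrow> bool" where
  "is_partition_of lam n \<longleftrightarrow>
     lam 0 = 0 \<and> (\<forall>i\<ge>1. lam (Suc i) \<le> lam i) \<and> finite {i. lam i > 0} \<and>
     (\<Sum>i | lam i > 0. lam i) = n"

definition num_parts :: "(nat \<Rightarrow> nat) \<Rightarrow> nat" where
  "num_parts lam = card {i. i \<ge> 1 \<and> lam i > 0}"

type_synonym node = "nat \<times> nat"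

definition nodes :: "(nat \<Rightarrow> nat) \<Rightarrow> node set" where
  "nodes lam = {(r, c). 1 \<le> r \<and> 1 \<le> c \<and> c \<le> lam r}"

text \<open>Throughout, \<open>e'\<close> is \<open>e + 1\<close>, and residues are represented in \<open>{0..e}\<close>.\<close>

definition residue :: "nat \<Rightarrow> nat \<Rightarrow> node \<Rightarrow> int" where
  "residue e rho = (\<lambda>(r, c). (int c - int r + int rho) mod int (e + 1))"


subsection \<open>The box construction\<close>

fun right_of :: "node \<Rightarrow> node" where
  "right_of (r, c) = (r, c + 1)"

fun below :: "node \<Rightarrow> node" where
  "below (r, c) = (r + 1, c)"

fun above :: "node \<Rightarrow> node" where
  "above (r, c) = (r - 1, c)"

definition is_strip :: "nat \<Rightarrow> nat \<Rightarrow> (nat \<Rightarrow> nat) \<Rightarrow> node list \<Rightarrow> bool" where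
  "is_strip e rho lam S \<longleftrightarrow>
     S \<noteq> [] \<and> (\<forall>A \<in> set S. A \<in> nodes lam \<and> residue e rho A \<in> {0, 1}) \<and>
     (\<forall>j. Suc j < length S \<longrightarrow>
        (residue e rho (S ! j) = 0 \<longrightarrow> S ! Suc j = right_of (S ! j)) \<and>
        (residue e rho (S ! j) = 1 \<longrightarrow> S ! Suc j = below (S ! j)))"

definition is_maximal_strip :: "nat \<Rightarrow> nat \<Rightarrow> (nat \<Rightarrow> nat) \<Rightarrow> node list \<Rightarrow> bool" where
  "is_maximal_strip e rho lam S \<longleftrightarrow>
     is_strip e rho lam S \<and> \<not> (\<exists>T. is_strip e rho lam T \<and> strict_sublist S T)"

text \<open>The 0-nodes lying in maximal strips that start with residue \<open>s\<close>.\<close>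

definition zero_nodes :: "nat \<Rightarrow> nat \<Rightarrow> (nat \<Rightarrow> nat) \<Rightarrow> int \<Rightarrow> node set" where
  "zero_nodes e rho lam s =
     {A. residue e rho A = 0 \<and>
         (\<exists>S. is_maximal_strip e rho lam S \<and> residue e rho (hd S) = s \<and> A \<in> set S)}"

definition move :: "nat \<Rightarrow> nat \<Rightarrow> (nat \<Rightarrow> nat) \<Rightarrow> node \<Rightarrow> node" where
  "move e rho lam = (\<lambda>(r, c).
     (r + card {r'. r' \<le> r \<and> (r', c) \<in> zero_nodes e rho lam 1},
      c + card {c'. c' < c \<and> (r, c') \<in> zero_nodes e rho lam 0}))"

text \<open>In the last set, \<open>above\<close> is applied only in rows \<open>\<ge> 2\<close>, since a 0-node in a maximal strip
  starting with 1 is itself moved down at least one step; no truncation occurs.\<close>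

definition plus_boxes :: "nat \<Rightarrow> nat \<Rightarrow> (nat \<Rightarrow> nat) \<Rightarrow> node set" where
  "plus_boxes e rho lam =
     move e rho lam ` nodes lam \<union>
     (\<lambda>A. right_of (move e rho lam A)) ` zero_nodes e rho lam 0 \<union>
     (\<lambda>A. above (move e rho lam A)) ` zero_nodes e rho lam 1"

definition row_lengths :: "node set \<Rightarrow> nat \<Rightarrow> nat" where
  "row_lengths B r = card {c. (r, c) \<in> B}"

definition box_plus :: "nat \<Rightarrow> nat \<Rightarrow> (nat \<Rightarrow> nat) \<Rightarrow> nat \<Rightarrow> nat" where
  "box_plus e rho lam = row_lengths (plus_boxes e rho lam)"


subsection \<open>The abacus construction\<close>

definition beta :: "nat \<Rightarrow> (nat \<Rightarrow> nat) \<Rightarrow> nat \<Rightarrow> int" where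
  "beta rho lam i = int (lam i) + int rho - int i"

definition level :: "nat \<Rightarrow> nat \<Rightarrow> (nat \<Rightarrow> nat) \<Rightarrow> nat \<Rightarrow> int" where
  "level e rho lam i = beta rho lam i div int (e + 1)"

definition runner :: "nat \<Rightarrow> nat \<Rightarrow> (nat \<Rightarrow> nat) \<Rightarrow> nat \<Rightarrow> int" where
  "runner e rho lam i = beta rho lam i mod int (e + 1)"

text \<open>An abacus is a set of beads, each given as a pair (runner, level); \<open>N\<close> is the top level.\<close>

type_synonym abacus = "(int \<times> int) set"

definition Ab :: "nat \<Rightarrow> nat \<Rightarrow> (nat \<Rightarrow> nat) \<Rightarrow> int \<Rightarrow> abacus" where
  "Ab e rho lam N = {(runner e rho lam i, level e rho lam i) | i. i \<ge> 1 \<and> level e rho lam i \<ge> N}"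

text \<open>Position numbers, charge and partition of an abacus with \<open>p\<close> runners and top level \<open>N\<close>.\<close>

definition positions :: "nat \<Rightarrow> abacus \<Rightarrow> int set" where
  "positions p X = (\<lambda>(b, a). a * int p + b) ` X"

definition abacus_charge :: "nat \<Rightarrow> int \<Rightarrow> abacus \<Rightarrow> int" where
  "abacus_charge p N X = int (card (positions p X)) + N * int p"

text \<open>The argument of \<open>nat\<close> is nonnegative for a finite abacus with all levels \<open>\<ge> N\<close>: the
  \<open>j\<close>-th largest of \<open>M\<close> distinct positions is at least \<open>N * p + M - j\<close>.\<close>

definition abacus_partition :: "nat \<Rightarrow> int \<Rightarrow> abacus \<Rightarrow> nat \<Rightarrow> nat" where
  "abacus_partition p N X j =
     (let xs = rev (sorted_list_of_set (positions p X))
      in if 1 \<le> j \<and> j \<le> length xs then nat (xs ! (j - 1) - abacus_charge p N X + int j) else 0)"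

definition N0 :: "nat \<Rightarrow> nat \<Rightarrow> (nat \<Rightarrow> nat) \<Rightarrow> int" where
  "N0 e rho lam =
     (let t = num_parts lam
      in if runner e rho lam (t + 1) = int e then level e rho lam (t + 1) + 1
         else level e rho lam (t + 1))"

definition k_num :: "nat \<Rightarrow> nat \<Rightarrow> (nat \<Rightarrow> nat) \<Rightarrow> nat" where
  "k_num e rho lam = card {i. i \<ge> 1 \<and> [i = rho] (mod (e + 1)) \<and> lam (i + 1) > 0}"

definition Ab_plus :: "nat \<Rightarrow> nat \<Rightarrow> (nat \<Rightarrow> nat) \<Rightarrow> int \<Rightarrow> abacus" where
  "Ab_plus e rho lam N =
     Ab e rho lam N \<union>
     {(int (e + 1), j) | j. N \<le> j \<and> j \<le> N0 e rho lam + int (k_num e rho lam) - 1}"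

definition abacus_plus :: "nat \<Rightarrow> nat \<Rightarrow> (nat \<Rightarrow> nat) \<Rightarrow> int \<Rightarrow> nat \<Rightarrow> nat" where
  "abacus_plus e rho lam N = abacus_partition (e + 2) N (Ab_plus e rho lam N)"

end

theory Submission
  imports Defs
begin

text \<open>Both constructions act on \<open>lam\<close> by repeating certain diagonals, and they repeat the same ones.
Put \<open>m = e + 1\<close> and attach to the node \<open>(r, c)\<close> the position \<open>z = rho + c - r\<close>; it depends
only on the diagonal. Nodes of residue 0 are those with \<open>m dvd z\<close>, and \<open>z < rho\<close> means \<open>c < r\<close>.

On the side of boxes, a strip zigzags between two neighbouring diagonals, and a maximal strip begins
on the border of the quarter plane: in the first row, with a 0-node, or in the first column, with a
1-node. So the 0-nodes with \<open>r \<le> c\<close> are those in strips starting with 0, and the 0-nodes with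
\<open>c < r\<close> are those in strips starting with 1 (\<open>zero_nodes_0_iff\<close>, \<open>zero_nodes_1_iff\<close>).
It follows that a node with \<open>r \<le> c\<close> stays in its row and a node with \<open>c < r\<close> stays in its
column, and that each moves by the number of multiples of \<open>m\<close> between its diagonal and the
diagonal at \<open>rho\<close> (\<open>move_upper\<close>, \<open>move_lower\<close>). The diagonals at the multiples of \<open>m\<close> are
thereby doubled.

On the side of abaci, \<open>(r, c)\<close> is a node exactly if at least \<open>r\<close> beads are at positions
\<open>\<ge> z\<close>; this works for every abacus, with its own charge in place of \<open>rho\<close>
(\<open>le_abacus_partition_iff\<close>, \<open>node_iff_beads_from\<close>). The new runner sends a bead at \<open>x\<close> to
\<open>spread m x = x + x div m\<close>, which inserts one position after every \<open>m\<close> old ones. The number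
\<open>k + N0\<close> is chosen such that the new runner is full exactly below the level \<open>(rho - 1) div m\<close>
(\<open>new_runner_height\<close>, for a nonempty partition). Then the new charge is
\<open>spread m (rho - 1) + 1\<close>, so that it cuts the new abacus where \<open>rho\<close> cuts the old one, and all
new positions below the cut are beads while those above the cut are gaps.

It remains to compare. Counting boxes in the new coordinates, the node \<open>(r, c)\<close> is moved to the
diagonal at position \<open>spread m (z - 1) + 1\<close>, and the box inserted at a 0-node lies on the
diagonal at \<open>spread m z\<close>; these two families exhaust all positions (\<open>position_cases\<close>). Above the
cut neither the row of a node nor the number of beads from its diagonal onwards changes. Below the cut the
row grows by the number of multiples of \<open>m\<close> passed, and the number of beads grows by the number
of beads of the new runner passed, which is the same
(\<open>card_positions_above_old\<close>, \<open>card_positions_above_new\<close>).\<close>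

section \<open>Positions after the insertion of a runner\<close>

text \<open>The position, among \<open>m + 1\<close> runners, of a bead that was at position \<open>x\<close> among \<open>m\<close> runners:
runner \<open>x mod m\<close> and level \<open>x div m\<close> are kept, see \<open>spread_decomp\<close>.\<close>

definition spread :: "int \<Rightarrow> int \<Rightarrow> int" where
  "spread m x = x + x div m"

lemma spread_decomp: "spread m x = (x div m) * (m + 1) + x mod m"
  unfolding spread_def distrib_left mult_1_right using div_mult_mod_eq[of x m] by linarith

lemma spread_less_iff:
  assumes "m > 0" shows "spread m x < spread m y \<longleftrightarrow> x < y"
proof -
  have mono: "spread m x < spread m y" if "x < y" for x y
    unfolding spread_def using that zdiv_mono1[of x y m] assms by linarith
  show ?thesis using mono[of x y] mono[of y x] by (metis linorder_less_linear not_less_iff_gr_or_eq)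
qed

lemma spread_le_iff:
  assumes "m > 0" shows "spread m x \<le> spread m y \<longleftrightarrow> x \<le> y"
  using spread_less_iff[OF assms, of y x] by linarith

lemma spread_multiple: "m > 0 \<Longrightarrow> spread m (k * m) = k * (m + 1)"
  by (simp add: spread_def distrib_left)

text \<open>Between the images of \<open>z - 1\<close> and \<open>z\<close> a position of the new runner is skipped when \<open>z\<close>
begins a level.\<close>

lemma spread_pred_multiple:
  assumes "m > 0" "m dvd z"
  shows "spread m z = spread m (z - 1) + 2" "(z - 1) div m = z div m - 1"
proof -
  obtain k where k: "z = m * k" using assms(2) by blast
  have "(z - 1) div m = ((m - 1) + m * (k - 1)) div m" unfolding k by (simp add: algebra_simps)
  also have "\<dots> = k - 1" using assms(1) by (subst div_mult_self2) auto
  finally show *: "(z - 1) div m = z div m - 1" using assms(1) k by simp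
  then show "spread m z = spread m (z - 1) + 2" unfolding spread_def by simp
qed

text \<open>The new runner is the last one, so its bead of level \<open>j\<close> comes after every old bead of level \<open>j\<close>
and before every old bead of level \<open>j + 1\<close>.\<close>

lemma spread_less_new_runner_iff:
  assumes "m > 0"
  shows "spread m x < j * (m + 1) + m \<longleftrightarrow> x div m \<le> j"
proof
  assume "x div m \<le> j"
  then have "(x div m) * (m + 1) \<le> j * (m + 1)" using assms by (intro mult_right_mono) auto
  then show "spread m x < j * (m + 1) + m"
    unfolding spread_decomp using pos_mod_bound[OF assms, of x] by linarith
next
  assume *: "spread m x < j * (m + 1) + m"
  show "x div m \<le> j"
  proof (rule ccontr)
    assume "\<not> x div m \<le> j"
    then have "(j + 1) * (m + 1) \<le> (x div m) * (m + 1)" using assms by (intro mult_right_mono) auto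
    moreover have "(j + 1) * (m + 1) = j * (m + 1) + m + 1" by (simp add: algebra_simps)
    ultimately show False using * pos_mod_sign[OF assms, of x] unfolding spread_decomp by linarith
  qed
qed

lemma spread_neq_new_runner:
  assumes "m > 0"
  shows "spread m x \<noteq> j * (m + 1) + m"
proof
  assume eq: "spread m x = j * (m + 1) + m"
  have "(spread m x) mod (m + 1) = x mod m"
    unfolding spread_decomp using assms pos_mod_sign[OF assms, of x] pos_mod_bound[OF assms, of x]
    by (simp add: mod_pos_pos_trivial)
  moreover have "(j * (m + 1) + m) mod (m + 1) = m" using assms by (simp add: mod_pos_pos_trivial)
  ultimately show False using eq pos_mod_bound[OF assms, of x] by simp
qed

text \<open>Case \<open>old\<close>: the preceding position is on an old runner. Case \<open>new\<close>: the preceding position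
is on the new runner, hence \<open>w\<close> begins a level. The first case will be met for the diagonals of moved
nodes, the second one for the diagonals of inserted boxes.\<close>

lemma position_cases:
  assumes "m > 0"
  obtains (old) z where "w = spread m (z - 1) + 1"
  | (new) z where "m dvd z" "w = spread m z"
proof -
  define a b where "a = (w - 1) div (m + 1)" and "b = (w - 1) mod (m + 1)"
  have w: "w - 1 = a * (m + 1) + b" unfolding a_def b_def by (rule div_mult_mod_eq[symmetric])
  have b: "0 \<le> b" "b \<le> m" using assms pos_mod_bound[of "m + 1" "w - 1"] by (auto simp: b_def)
  show thesis
  proof (cases "b = m")
    case True
    have "spread m (m * (a + 1)) = w" using w assms True by (simp add: spread_def algebra_simps)
    then show thesis using new[of "m * (a + 1)"] by simp
  next
    case False
    then have "(b + m * a) div m = a" using assms b by simp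
    then have "spread m (b + m * a + 1 - 1) + 1 = w" using w by (simp add: spread_def algebra_simps)
    then show thesis using old[of "b + m * a + 1"] by simp
  qed
qed

lemma int_div_less_iff:
  fixes m :: int
  assumes "m > 0"
  shows "x div m < k \<longleftrightarrow> x < m * k"
proof
  assume "x div m < k"
  then have "m * (x div m + 1) \<le> m * k" using assms by (intro mult_left_mono) auto
  then show "x < m * k" unfolding distrib_left
    using pos_mod_bound[OF assms, of x] mult_div_mod_eq[of m x] by linarith
next
  assume "x < m * k"
  show "x div m < k"
  proof (rule ccontr)
    assume "\<not> x div m < k"
    then have "m * k \<le> m * (x div m)" using assms by (intro mult_left_mono) auto
    then show False using \<open>x < m * k\<close> pos_mod_sign[OF assms, of x] mult_div_mod_eq[of m x] by linarith
  qed
qed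

lemma card_multiples:
  fixes a b m :: int
  assumes "m > 0" "a \<le> b"
  shows "int (card {x. a \<le> x \<and> x < b \<and> m dvd x}) = (b - 1) div m - (a - 1) div m"
proof -
  have div_less: "x div m < k \<longleftrightarrow> x < m * k" for x k
    using int_div_less_iff[OF assms(1)] .
  have *: "(a - 1) div m < k \<and> k \<le> (b - 1) div m \<longleftrightarrow> a \<le> m * k \<and> m * k < b" for k
    using div_less[of "a - 1" k] div_less[of "b - 1" k] by linarith
  have "{x. a \<le> x \<and> x < b \<and> m dvd x} = (\<lambda>k. m * k) ` {(a - 1) div m <.. (b - 1) div m}"
  proof (intro equalityI subsetI)
    fix x assume "x \<in> {x. a \<le> x \<and> x < b \<and> m dvd x}"
    moreover then obtain k where "x = m * k" by blast
    ultimately show "x \<in> (\<lambda>k. m * k) ` {(a - 1) div m <.. (b - 1) div m}" using *[of k] by auto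
  next
    fix x assume "x \<in> (\<lambda>k. m * k) ` {(a - 1) div m <.. (b - 1) div m}"
    then obtain k where x: "x = m * k" and "k \<in> {(a - 1) div m <.. (b - 1) div m}"
      by (rule imageE)
    then have "a \<le> m * k \<and> m * k < b" unfolding greaterThanAtMost_iff using * by blast
    then show "x \<in> {x. a \<le> x \<and> x < b \<and> m dvd x}" unfolding x by simp
  qed
  moreover have "inj_on (\<lambda>k. m * k) A" for A using assms(1) by (auto simp: inj_on_def)
  ultimately have "card {x. a \<le> x \<and> x < b \<and> m dvd x} = nat ((b - 1) div m - (a - 1) div m)"
    by (simp add: card_image)
  then show ?thesis using zdiv_mono1[of "a - 1" "b - 1" m] assms by simp
qed

section \<open>Partitions of abaci and bead counts\<close>

text \<open>Sorted lists of beads are avoided from here on: a bound on the \<open>j\<close>-th largest bead is a bound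
on the number of large beads.\<close>

lemma nth_rev_ge_iff:
  fixes P :: "int set"
  assumes "finite P" "1 \<le> j" "j \<le> card P"
  shows "w \<le> rev (sorted_list_of_set P) ! (j - 1) \<longleftrightarrow> j \<le> card {x \<in> P. w \<le> x}"
proof -
  define xs where "xs = rev (sorted_list_of_set P)"
  have len: "length xs = card P" and set: "set xs = P" and dist: "distinct xs"
    using assms(1) by (auto simp: xs_def)
  have desc: "xs ! b < xs ! a" if "a < b" "b < card P" for a b
    using strict_sorted_list_of_set[of P] that assms(1)
    unfolding xs_def by (auto simp: rev_nth sorted_wrt_iff_nth_less)
  have P: "{x \<in> P. w \<le> x} = (\<lambda>i. xs ! i) ` {i. i < card P \<and> w \<le> xs ! i}"
    using set len by (auto simp: in_set_conv_nth image_iff)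
  have inj: "inj_on (\<lambda>i. xs ! i) {i. i < card P \<and> w \<le> xs ! i}"
    using dist len by (auto simp: inj_on_def nth_eq_iff_index_eq)
  have cardP: "card {x \<in> P. w \<le> x} = card {i. i < card P \<and> w \<le> xs ! i}"
    unfolding P by (rule card_image[OF inj])
  show ?thesis unfolding xs_def[symmetric] cardP
  proof
    assume *: "w \<le> xs ! (j - 1)"
    have "w \<le> xs ! i" if "i < j" for i
      using * desc[of i "j - 1"] that assms by (cases "i = j - 1") force+
    then have "{..<j} \<subseteq> {i. i < card P \<and> w \<le> xs ! i}" using assms by auto
    from card_mono[OF _ this] show "j \<le> card {i. i < card P \<and> w \<le> xs ! i}" by simp
  next
    assume *: "j \<le> card {i. i < card P \<and> w \<le> xs ! i}"
    show "w \<le> xs ! (j - 1)"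
    proof (rule ccontr)
      assume n: "\<not> w \<le> xs ! (j - 1)"
      have "i < j - 1" if "i < card P" "w \<le> xs ! i" for i
      proof (rule ccontr)
        assume "\<not> i < j - 1"
        then show False using desc[of "j - 1" i] that n by (cases "i = j - 1") auto
      qed
      then have "{i. i < card P \<and> w \<le> xs ! i} \<subseteq> {..<j - 1}" by auto
      from card_mono[OF _ this] * assms show False by simp
    qed
  qed
qed

text \<open>In terms of diagrams: the box \<open>(j, C)\<close> belongs to the partition of an abacus iff at least \<open>j\<close>
beads are at or after the position of its diagonal.\<close>

lemma le_abacus_partition_iff:
  assumes "finite (positions p X)" "1 \<le> j" "1 \<le> C"
  shows "C \<le> abacus_partition p N X j \<longleftrightarrow>
    j \<le> card {x \<in> positions p X. abacus_charge p N X + int C - int j \<le> x}"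
proof (cases "j \<le> card (positions p X)")
  case True
  have "C \<le> abacus_partition p N X j \<longleftrightarrow>
    abacus_charge p N X + int C - int j \<le> rev (sorted_list_of_set (positions p X)) ! (j - 1)"
    using True assms unfolding abacus_partition_def Let_def by auto
  then show ?thesis using nth_rev_ge_iff[OF assms(1,2) True] by simp
next
  case False
  have "card {x \<in> positions p X. abacus_charge p N X + int C - int j \<le> x} \<le> card (positions p X)"
    by (rule card_mono) (use assms in auto)
  then show ?thesis using False assms unfolding abacus_partition_def Let_def by auto
qed

lemma initial_segment:
  assumes "finite A" "0 \<notin> A" "\<And>i j. i \<in> A \<Longrightarrow> 1 \<le> j \<Longrightarrow> j \<le> i \<Longrightarrow> j \<in> A"
  shows "A = {1..card A :: nat}"
proof (cases "A = {}")
  case False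
  have "A = {1..Max A}"
  proof (intro equalityI subsetI)
    fix i assume "i \<in> A"
    then show "i \<in> {1..Max A}" using assms(1,2) by (cases i) auto
  next
    fix i assume "i \<in> {1..Max A}"
    then show "i \<in> A" using assms(3)[of "Max A" i] Max_in[OF assms(1) False] by simp
  qed
  then show ?thesis by (metis card_atLeastAtMost diff_Suc_1)
qed simp

lemma int_div_Suc:
  fixes x m :: int
  assumes "m > 0"
  shows "(x + 1) div m = (if x mod m = m - 1 then x div m + 1 else x div m)"
proof (cases "x mod m = m - 1")
  case True
  then have "x + 1 = m * (x div m + 1)" using mult_div_mod_eq[of m x] by (simp add: distrib_left)
  then show ?thesis using True assms by simp
next
  case False
  have "(x + 1) div m = ((x mod m + 1) + m * (x div m)) div m" by (simp add: add.commute)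
  also have "\<dots> = x div m + (x mod m + 1) div m" using assms by (subst div_mult_self2) auto
  also have "(x mod m + 1) div m = 0"
    using False pos_mod_sign[OF assms, of x] pos_mod_bound[OF assms, of x]
    by (intro div_pos_pos_trivial) linarith+
  finally have "(x + 1) div m = x div m" by simp
  then show ?thesis using False by simp
qed

section \<open>Strips and the two kinds of 0-nodes\<close>

locale charged_partition =
  fixes e rho :: nat and lam :: "nat \<Rightarrow> nat"
  assumes e_pos: "1 \<le> e" and rho_le: "rho \<le> e"
    and lam_Suc_le: "1 \<le> i \<Longrightarrow> lam (Suc i) \<le> lam i"
    and finite_parts: "finite {i. lam i > 0}"
begin

abbreviation m :: int where "m \<equiv> int e + 1"

lemma lam_antimono:
  assumes "1 \<le> i" "i \<le> j"
  shows "lam j \<le> lam i"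
  using assms(2)
proof (induction j rule: dec_induct)
  case (step k)
  then show ?case using lam_Suc_le[of k] assms(1) by simp
qed simp

lemma nodes_closed:
  "(r, c) \<in> nodes lam \<Longrightarrow> 1 \<le> r' \<Longrightarrow> r' \<le> r \<Longrightarrow> 1 \<le> c' \<Longrightarrow> c' \<le> c \<Longrightarrow> (r', c') \<in> nodes lam"
  using lam_antimono[of r' r] by (auto simp: nodes_def)

lemma finite_nodes: "finite (nodes lam)"
proof (rule finite_subset)
  show "nodes lam \<subseteq> (SIGMA r:{i. lam i > 0}. {..lam r})" by (auto simp: nodes_def)
qed (use finite_parts in auto)

lemma residue_0_iff: "residue e rho (r, c) = 0 \<longleftrightarrow> m dvd int rho + int c - int r"
  by (simp add: residue_def dvd_eq_mod_eq_0 algebra_simps)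

lemma residue_1_iff: "residue e rho (r, c) = 1 \<longleftrightarrow> m dvd int rho + int c - int r - 1"
proof -
  have "(1 :: int) = 1 mod m" using e_pos by simp
  then have "residue e rho (r, c) = 1 \<longleftrightarrow> (int c - int r + int rho) mod m = 1 mod m"
    by (simp add: residue_def add.commute)
  also have "\<dots> \<longleftrightarrow> m dvd int rho + int c - int r - 1"
    by (simp add: mod_eq_dvd_iff algebra_simps)
  finally show ?thesis .
qed

text \<open>A step to the right raises content and residue by 1, a step down lowers both by 1. Their difference is
therefore constant along a strip; on the 0-nodes it is the content.\<close>

definition strip_content :: "node \<Rightarrow> int" where
  "strip_content A = int (snd A) - int (fst A) - residue e rho A"

text \<open>The second conjunct shows that a strip never repeats a node, which bounds its length.\<close>

lemma strip_nth:
  assumes "is_strip e rho lam S" "j < length S"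
  shows "strip_content (S ! j) = strip_content (hd S) \<and>
    fst (S ! j) + snd (S ! j) = fst (hd S) + snd (hd S) + j"
  using assms(2)
proof (induction j)
  case 0
  then show ?case by (cases S) auto
next
  case (Suc j)
  obtain r c where A: "S ! j = (r, c)" by fastforce
  have "residue e rho (r, c) \<in> {0, 1}" using assms(1) Suc.prems A nth_mem[of j S]
    unfolding is_strip_def by fastforce
  then consider "residue e rho (r, c) = 0" "S ! Suc j = (r, Suc c)"
    | "residue e rho (r, c) = 1" "S ! Suc j = (Suc r, c)"
    using assms(1) Suc.prems A unfolding is_strip_def by force
  then show ?case
  proof cases
    case 1
    then have "residue e rho (r, Suc c) = 1"
      unfolding residue_0_iff residue_1_iff by (simp add: algebra_simps)
    then show ?thesis using 1 Suc A by (simp add: strip_content_def)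
  next
    case 2
    then have "residue e rho (Suc r, c) = 0"
      unfolding residue_0_iff residue_1_iff by (simp add: algebra_simps)
    then show ?thesis using 2 Suc A by (simp add: strip_content_def)
  qed
qed

lemma length_strip_le:
  assumes "is_strip e rho lam S"
  shows "length S \<le> card (nodes lam)"
proof -
  have "distinct S"
    unfolding distinct_conv_nth using strip_nth[OF assms] by (metis add_left_cancel)
  moreover have "set S \<subseteq> nodes lam" using assms by (auto simp: is_strip_def)
  ultimately show ?thesis using card_mono[OF finite_nodes] distinct_card by metis
qed

text \<open>Among the strips through \<open>A\<close>, one of greatest length is maximal.\<close>

lemma ex_maximal_strip:
  assumes "A \<in> nodes lam" "residue e rho A = 0"
  obtains S where "is_maximal_strip e rho lam S" "A \<in> set S"
proof -
  let ?Q = "\<lambda>S. is_strip e rho lam S \<and> A \<in> set S"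
  have "?Q [A]" using assms by (simp add: is_strip_def)
  moreover have "\<forall>S. ?Q S \<longrightarrow> length S < Suc (card (nodes lam))"
    using length_strip_le by (auto simp: less_Suc_eq_le)
  ultimately obtain S where S: "?Q S" and max: "\<forall>T. ?Q T \<longrightarrow> length T \<le> length S"
    using ex_has_greatest_nat[of ?Q "[A]" length] by blast
  have False if T: "is_strip e rho lam T" "strict_sublist S T" for T
  proof -
    obtain ps ss where T': "T = ps @ S @ ss" "T \<noteq> S"
      using T(2) by (auto simp: sublist_def strict_sublist_def)
    then have "?Q T" using S T(1) by simp
    then show False using max T' by fastforce
  qed
  then show thesis using that[of S] S by (auto simp: is_maximal_strip_def)
qed

lemma not_maximal_if_Cons:
  assumes "is_strip e rho lam (B # S)"
  shows "\<not> is_maximal_strip e rho lam S"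
proof -
  have "strict_sublist S (B # S)" by (auto simp: strict_sublist_def sublist_Cons_right)
  then show ?thesis using assms by (auto simp: is_maximal_strip_def)
qed

lemma strip_Cons:
  assumes "is_strip e rho lam S" "B \<in> nodes lam" "residue e rho B \<in> {0, 1}"
    and "residue e rho B = 0 \<Longrightarrow> hd S = right_of B" "residue e rho B = 1 \<Longrightarrow> hd S = below B"
  shows "is_strip e rho lam (B # S)"
  unfolding is_strip_def
proof (intro conjI allI impI ballI)
  fix j assume j: "Suc j < length (B # S)"
  have hd: "S ! 0 = hd S" using assms(1) by (simp add: is_strip_def hd_conv_nth)
  show "(B # S) ! Suc j = right_of ((B # S) ! j)" if "residue e rho ((B # S) ! j) = 0"
    using that assms j hd by (cases j) (auto simp: is_strip_def)
  show "(B # S) ! Suc j = below ((B # S) ! j)" if "residue e rho ((B # S) ! j) = 1"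
    using that assms j hd by (cases j) (auto simp: is_strip_def)
qed (use assms in \<open>auto simp: is_strip_def\<close>)

text \<open>A strip can be prolonged backwards from a 0-node by the 1-node above it, and from a 1-node by the
0-node on its left, unless that node is outside the quarter plane.\<close>

lemma hd_maximal_strip:
  assumes "is_maximal_strip e rho lam S" "hd S = (r, c)"
  shows "residue e rho (r, c) = 0 \<and> r = 1 \<or> residue e rho (r, c) = 1 \<and> c = 1"
proof -
  have S: "is_strip e rho lam S" using assms(1) by (simp add: is_maximal_strip_def)
  then have A: "(r, c) \<in> nodes lam" and res: "residue e rho (r, c) \<in> {0, 1}"
    using assms(2) hd_in_set[of S] by (auto simp: is_strip_def)
  have rc: "1 \<le> r" "1 \<le> c" using A by (auto simp: nodes_def)
  have False if "residue e rho (r, c) = 0" "r \<noteq> 1"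
  proof -
    have r: "2 \<le> r" using that rc by simp
    then have "residue e rho (r - 1, c) = 1" using that(1)
      unfolding residue_0_iff residue_1_iff by (simp add: of_nat_diff algebra_simps)
    moreover have "(r - 1, c) \<in> nodes lam" using nodes_closed[OF A, of "r - 1" c] r rc by simp
    ultimately show False using strip_Cons[OF S, of "(r - 1, c)"] assms not_maximal_if_Cons r by auto
  qed
  moreover have False if "residue e rho (r, c) = 1" "c \<noteq> 1"
  proof -
    have c: "2 \<le> c" using that rc by simp
    then have "residue e rho (r, c - 1) = 0" using that(1)
      unfolding residue_0_iff residue_1_iff by (simp add: of_nat_diff algebra_simps)
    moreover have "(r, c - 1) \<in> nodes lam" using nodes_closed[OF A, of r "c - 1"] c rc by simp
    ultimately show False using strip_Cons[OF S, of "(r, c - 1)"] assms not_maximal_if_Cons c by auto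
  qed
  ultimately show ?thesis using res by auto
qed

text \<open>If the strip starts with 0, then it starts in row 1, so its 0-nodes have content at least 0; if it
starts with 1, then it starts in column 1 with a content at most 0, and its 0-nodes lie one diagonal lower.\<close>

lemma maximal_strip_start:
  assumes S: "is_maximal_strip e rho lam S" and A: "(r, c) \<in> set S" "residue e rho (r, c) = 0"
  shows "residue e rho (hd S) = (if r \<le> c then 0 else 1)"
proof -
  obtain r0 c0 where hd: "hd S = (r0, c0)" by fastforce
  have strip: "is_strip e rho lam S" using S by (simp add: is_maximal_strip_def)
  obtain j where "j < length S" "S ! j = (r, c)" using A(1) by (auto simp: in_set_conv_nth)
  then have "strip_content (r, c) = strip_content (r0, c0)" using strip_nth[OF strip] hd by metis
  then have "int c - int r = int c0 - int r0 - residue e rho (r0, c0)"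
    using A by (simp add: strip_content_def)
  moreover have "(r0, c0) \<in> nodes lam" using strip hd hd_in_set[of S] by (auto simp: is_strip_def)
  then have "1 \<le> r0" "1 \<le> c0" by (auto simp: nodes_def)
  ultimately show ?thesis using hd_maximal_strip[OF S hd] hd by auto
qed

lemma zero_nodes_0_iff:
  "(r, c) \<in> zero_nodes e rho lam 0 \<longleftrightarrow>
     (r, c) \<in> nodes lam \<and> m dvd int rho + int c - int r \<and> r \<le> c"
  and zero_nodes_1_iff:
  "(r, c) \<in> zero_nodes e rho lam 1 \<longleftrightarrow>
     (r, c) \<in> nodes lam \<and> m dvd int rho + int c - int r \<and> c < r"
proof -
  have "(r, c) \<in> zero_nodes e rho lam s \<longleftrightarrow> (r, c) \<in> nodes lam \<and>
     residue e rho (r, c) = 0 \<and> s = (if r \<le> c then 0 else 1)" for s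
  proof
    assume "(r, c) \<in> zero_nodes e rho lam s"
    then obtain S where S: "is_maximal_strip e rho lam S" "residue e rho (hd S) = s" "(r, c) \<in> set S"
      "residue e rho (r, c) = 0" by (auto simp: zero_nodes_def)
    then show "(r, c) \<in> nodes lam \<and> residue e rho (r, c) = 0 \<and> s = (if r \<le> c then 0 else 1)"
      using maximal_strip_start[OF S(1,3,4)] by (auto simp: is_maximal_strip_def is_strip_def)
  next
    assume *: "(r, c) \<in> nodes lam \<and> residue e rho (r, c) = 0 \<and> s = (if r \<le> c then 0 else 1)"
    then obtain S where "is_maximal_strip e rho lam S" "(r, c) \<in> set S"
      using ex_maximal_strip by blast
    then show "(r, c) \<in> zero_nodes e rho lam s"
      using * maximal_strip_start[of S r c] by (auto simp: zero_nodes_def)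
  qed
  note * = this
  show "(r, c) \<in> zero_nodes e rho lam 0 \<longleftrightarrow>
     (r, c) \<in> nodes lam \<and> m dvd int rho + int c - int r \<and> r \<le> c"
    unfolding * residue_0_iff by auto
  show "(r, c) \<in> zero_nodes e rho lam 1 \<longleftrightarrow>
     (r, c) \<in> nodes lam \<and> m dvd int rho + int c - int r \<and> c < r"
    unfolding * residue_0_iff by auto
qed

section \<open>The box construction on diagonals\<close>

text \<open>The charge of the enlarged abacus of a nonempty partition. It equals \<open>spread m (rho - 1) + 1\<close>, the
position that follows the image of \<open>rho - 1\<close>.\<close>

definition charge_plus :: int where
  "charge_plus = int rho + (int rho - 1) div m"

text \<open>The shift is the number of multiples of \<open>m\<close> in the interval from \<open>rho\<close> up to, but excluding,
the position of the node. The last equation places the moved node on a diagonal that depends only on the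
diagonal of the node.\<close>

lemma move_upper:
  assumes node: "(r, c) \<in> nodes lam" and "r \<le> c"
  obtains C where "move e rho lam (r, c) = (r, C)" "c \<le> C"
    "charge_plus + int C - int r = spread m (int rho + int c - int r - 1) + 1"
proof -
  let ?f = "\<lambda>c'. int rho + int c' - int r"
  have rc: "1 \<le> r" "1 \<le> c" using node by (auto simp: nodes_def)
  define A where "A = {c'. c' < c \<and> (r, c') \<in> zero_nodes e rho lam 0}"
  have "{r'. r' \<le> r \<and> (r', c) \<in> zero_nodes e rho lam 1} = {}"
    using assms(2) by (auto simp: zero_nodes_1_iff)
  then have move: "move e rho lam (r, c) = (r, c + card A)"
    unfolding move_def A_def by simp
  have A: "A = {c'. r \<le> c' \<and> c' < c \<and> m dvd ?f c'}"
    using nodes_closed[OF node, of r] rc by (auto simp: A_def zero_nodes_0_iff)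
  have "?f ` A = {x. int rho \<le> x \<and> x < ?f c \<and> m dvd x}"
  proof (intro equalityI subsetI)
    fix x assume x: "x \<in> {x. int rho \<le> x \<and> x < ?f c \<and> m dvd x}"
    then have "x = ?f (nat (x - int rho + int r))" by simp
    moreover have "nat (x - int rho + int r) \<in> A" using x unfolding A by auto
    ultimately show "x \<in> ?f ` A" by blast
  qed (auto simp: A)
  moreover have "inj_on ?f A" by (auto simp: inj_on_def)
  ultimately have "card A = card {x. int rho \<le> x \<and> x < ?f c \<and> m dvd x}"
    by (metis card_image)
  then have "int (card A) = (?f c - 1) div m - (int rho - 1) div m"
    using card_multiples[of m "int rho" "?f c"] assms(2) by simp
  then show thesis using that[OF move] by (simp add: charge_plus_def spread_def)
qed

text \<open>The same as for \<open>move_upper\<close>, with columns in place of rows. The interval now runs from the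
position of the node, included, to \<open>rho\<close>: a 0-node is itself pushed down.
The resulting diagonal is given by the same formula in both lemmas.\<close>

lemma move_lower:
  assumes node: "(r, c) \<in> nodes lam" and "c < r"
  obtains R where "move e rho lam (r, c) = (R, c)" "r \<le> R"
    "charge_plus + int c - int R = spread m (int rho + int c - int r - 1) + 1"
proof -
  let ?f = "\<lambda>r'. int rho + int c - int r'"
  have rc: "1 \<le> r" "1 \<le> c" using node by (auto simp: nodes_def)
  define A where "A = {r'. r' \<le> r \<and> (r', c) \<in> zero_nodes e rho lam 1}"
  have "{c'. c' < c \<and> (r, c') \<in> zero_nodes e rho lam 0} = {}"
    using assms(2) by (auto simp: zero_nodes_0_iff)
  then have move: "move e rho lam (r, c) = (r + card A, c)"
    unfolding move_def A_def by simp
  have A: "A = {r'. c < r' \<and> r' \<le> r \<and> m dvd ?f r'}"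
    using nodes_closed[OF node, of _ c] rc by (auto simp: A_def zero_nodes_1_iff)
  have "?f ` A = {x. ?f r \<le> x \<and> x < int rho \<and> m dvd x}"
  proof (intro equalityI subsetI)
    fix x assume x: "x \<in> {x. ?f r \<le> x \<and> x < int rho \<and> m dvd x}"
    then have "x = ?f (nat (int rho + int c - x))" by simp
    moreover have "nat (int rho + int c - x) \<in> A" using x unfolding A by auto
    ultimately show "x \<in> ?f ` A" by blast
  qed (auto simp: A)
  moreover have "inj_on ?f A" by (auto simp: inj_on_def)
  ultimately have "card A = card {x. ?f r \<le> x \<and> x < int rho \<and> m dvd x}"
    by (metis card_image)
  then have "int (card A) = (int rho - 1) div m - (?f r - 1) div m"
    using card_multiples[of m "?f r" "int rho"] assms(2) by simp
  then show thesis using that[OF move] by (simp add: charge_plus_def spread_def)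
qed

section \<open>Bead counts of the partition\<close>

lemma parts_eq: "{i. 1 \<le> i \<and> lam i > 0} = {1..num_parts lam}"
proof -
  have "{i. 1 \<le> i \<and> lam i > 0} = {1..card {i. 1 \<le> i \<and> lam i > 0}}"
  proof (rule initial_segment)
    show "finite {i. 1 \<le> i \<and> lam i > 0}" by (rule finite_subset[OF _ finite_parts]) auto
    show "j \<in> {i. 1 \<le> i \<and> lam i > 0}" if "i \<in> {i. 1 \<le> i \<and> lam i > 0}" "1 \<le> j" "j \<le> i" for i j
      using that lam_antimono[of j i] by auto
  qed simp
  then show ?thesis by (simp add: num_parts_def)
qed

lemma lam_pos_iff: "1 \<le> i \<Longrightarrow> lam i > 0 \<longleftrightarrow> i \<le> num_parts lam"
  using parts_eq by (auto simp: set_eq_iff)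

lemma beta_less: "1 \<le> i \<Longrightarrow> i < j \<Longrightarrow> beta rho lam j < beta rho lam i"
  using lam_antimono[of i j] by (simp add: beta_def)

definition beads_from :: "int \<Rightarrow> nat" where
  "beads_from z = card {i. 1 \<le> i \<and> z \<le> beta rho lam i}"

lemma beads_from_set: "{i. 1 \<le> i \<and> z \<le> beta rho lam i} = {1..beads_from z}"
  unfolding beads_from_def
proof (rule initial_segment)
  have "i \<le> num_parts lam + nat (int rho - z)" if "1 \<le> i" "z \<le> beta rho lam i" for i
    using that lam_pos_iff[of i] by (cases "lam i = 0") (auto simp: beta_def)
  then have "{i. 1 \<le> i \<and> z \<le> beta rho lam i} \<subseteq> {..num_parts lam + nat (int rho - z)}" by auto
  then show "finite {i. 1 \<le> i \<and> z \<le> beta rho lam i}" by (rule finite_subset) simp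
  show "j \<in> {i. 1 \<le> i \<and> z \<le> beta rho lam i}"
    if "i \<in> {i. 1 \<le> i \<and> z \<le> beta rho lam i}" "1 \<le> j" "j \<le> i" for i j
    using that beta_less[of j i] by (cases "i = j") auto
qed simp

lemma le_beads_from_iff: "1 \<le> r \<Longrightarrow> r \<le> beads_from z \<longleftrightarrow> z \<le> beta rho lam r"
  using beads_from_set[of z] by (auto simp: set_eq_iff)

lemma node_iff_beads_from:
  "1 \<le> r \<Longrightarrow> 1 \<le> c \<Longrightarrow> (r, c) \<in> nodes lam \<longleftrightarrow> r \<le> beads_from (int rho + int c - int r)"
  by (simp add: le_beads_from_iff nodes_def beta_def)

text \<open>From the bead of the first zero part downwards there are no gaps, so the bead count is the same as for
the empty partition.\<close>

lemma beads_from_low: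
  assumes "z \<le> int rho - int (num_parts lam)"
  shows "int (beads_from z) = int rho - z"
proof -
  have "{i. 1 \<le> i \<and> z \<le> beta rho lam i} = {1..nat (int rho - z)}"
  proof -
    have "z \<le> beta rho lam i \<longleftrightarrow> i \<le> nat (int rho - z)" if "1 \<le> i" for i
      using assms lam_pos_iff[OF that] by (cases "lam i = 0") (auto simp: beta_def)
    then show ?thesis by auto
  qed
  then show ?thesis using assms by (simp add: beads_from_def)
qed

text \<open>The case distinction in the definition of \<open>N0\<close> rounds upwards: \<open>N0\<close> is the level of the
position after the bead of the first zero part.\<close>

lemma N0_eq: "N0 e rho lam = (int rho - int (num_parts lam)) div m"
proof -
  let ?t = "num_parts lam"
  have "lam (?t + 1) = 0" using lam_pos_iff[of "?t + 1"] by simp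
  then have "beta rho lam (?t + 1) = int rho - int ?t - 1" by (simp add: beta_def)
  then show ?thesis using int_div_Suc[of m "int rho - int ?t - 1"]
    by (simp add: N0_def Let_def runner_def level_def add.commute)
qed

text \<open>\<open>k_num\<close> counts the multiples of \<open>m\<close> among the numbers \<open>rho - i\<close> with \<open>1 \<le> i < t\<close>,
where \<open>t\<close> is the number of parts.
For \<open>t = 0\<close> the formula can fail: with \<open>rho = 0\<close> its right-hand side is \<open>-1\<close>.\<close>

lemma k_num_eq:
  assumes "num_parts lam \<ge> 1"
  shows "int (k_num e rho lam) = (int rho - 1) div m - (int rho - int (num_parts lam)) div m"
proof -
  let ?t = "num_parts lam"
  let ?f = "\<lambda>i. int rho - int i"
  define A where "A = {i. i \<ge> 1 \<and> [i = rho] (mod (e + 1)) \<and> lam (i + 1) > 0}"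
  have "[i = rho] (mod (e + 1)) \<longleftrightarrow> m dvd ?f i" for i
  proof -
    have "[i = rho] (mod (e + 1)) \<longleftrightarrow> [int rho = int i] (mod int (e + 1))"
      by (simp only: cong_int_iff cong_sym_eq)
    then show ?thesis by (simp add: cong_iff_dvd_diff add.commute)
  qed
  then have A: "A = {i. 1 \<le> i \<and> i < ?t \<and> m dvd ?f i}"
    using lam_pos_iff by (auto simp: A_def)
  have "?f ` A = {x. int rho - int ?t + 1 \<le> x \<and> x < int rho \<and> m dvd x}"
  proof (intro equalityI subsetI)
    fix x assume x: "x \<in> {x. int rho - int ?t + 1 \<le> x \<and> x < int rho \<and> m dvd x}"
    then have "x = ?f (nat (int rho - x))" by simp
    moreover have "nat (int rho - x) \<in> A" using x unfolding A by auto
    ultimately show "x \<in> ?f ` A" by blast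
  qed (auto simp: A)
  moreover have "inj_on ?f A" by (auto simp: inj_on_def)
  ultimately have "card A = card {x. int rho - int ?t + 1 \<le> x \<and> x < int rho \<and> m dvd x}"
    by (metis card_image)
  then show ?thesis
    using card_multiples[of m "int rho - int ?t + 1" "int rho"] assms
    by (simp add: k_num_def A_def)
qed

section \<open>Bead counts of the enlarged abacus\<close>

lemma positions_Ab_plus:
  "positions (e + 2) (Ab_plus e rho lam N) =
     (\<lambda>i. spread m (beta rho lam i)) ` {i. 1 \<le> i \<and> N * m \<le> beta rho lam i} \<union>
     (\<lambda>j. j * (m + 1) + m) ` {N..<N0 e rho lam + int (k_num e rho lam)}"
proof -
  have level: "N \<le> level e rho lam i \<longleftrightarrow> N * m \<le> beta rho lam i" for i
    using int_div_less_iff[of m "beta rho lam i" N] by (simp add: level_def mult.commute add.commute not_less[symmetric])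
  have "Ab_plus e rho lam N =
     (\<lambda>i. (runner e rho lam i, level e rho lam i)) ` {i. 1 \<le> i \<and> N * m \<le> beta rho lam i} \<union>
     (\<lambda>j. (m, j)) ` {N..<N0 e rho lam + int (k_num e rho lam)}"
    unfolding Ab_plus_def Ab_def level by auto
  moreover have "level e rho lam i * int (e + 2) + runner e rho lam i = spread m (beta rho lam i)" for i
    unfolding spread_decomp by (simp add: level_def runner_def algebra_simps)
  moreover have "j * int (e + 2) + m = j * (m + 1) + m" for j by (simp add: algebra_simps)
  ultimately show ?thesis unfolding positions_def by (simp add: image_Un image_image)
qed

lemma finite_positions_Ab_plus: "finite (positions (e + 2) (Ab_plus e rho lam N))"
  unfolding positions_Ab_plus beads_from_set by simp

lemma card_positions_ge:
  "card {x \<in> positions (e + 2) (Ab_plus e rho lam N). w \<le> x} =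
     card {i. 1 \<le> i \<and> N * m \<le> beta rho lam i \<and> w \<le> spread m (beta rho lam i)} +
     card {j. N \<le> j \<and> j < N0 e rho lam + int (k_num e rho lam) \<and> w \<le> j * (m + 1) + m}"
proof -
  define I J where "I = {i. 1 \<le> i \<and> N * m \<le> beta rho lam i \<and> w \<le> spread m (beta rho lam i)}"
    and "J = {j. N \<le> j \<and> j < N0 e rho lam + int (k_num e rho lam) \<and> w \<le> j * (m + 1) + m}"
  let ?f = "\<lambda>i. spread m (beta rho lam i)" and ?g = "\<lambda>j. j * (m + 1) + m"
  have "{x \<in> positions (e + 2) (Ab_plus e rho lam N). w \<le> x} = ?f ` I \<union> ?g ` J"
    unfolding positions_Ab_plus I_def J_def by auto
  moreover have "finite I"
  proof (rule finite_subset)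
    show "I \<subseteq> {1..beads_from (N * m)}" unfolding beads_from_set[symmetric] I_def by auto
  qed simp
  moreover have "finite J"
    by (rule finite_subset[of _ "{N..<N0 e rho lam + int (k_num e rho lam)}"]) (auto simp: J_def)
  moreover have "?f ` I \<inter> ?g ` J = {}" using spread_neq_new_runner[of m] by auto
  moreover have "inj_on ?f I"
  proof (rule inj_onI)
    fix a b assume ab: "a \<in> I" "b \<in> I" "?f a = ?f b"
    then have "beta rho lam a = beta rho lam b"
      using spread_less_iff[of m "beta rho lam a" "beta rho lam b"]
        spread_less_iff[of m "beta rho lam b" "beta rho lam a"] by simp
    moreover have "1 \<le> a" "1 \<le> b" using ab by (auto simp: I_def)
    ultimately show "a = b" using beta_less[of a b] beta_less[of b a]
      by (cases a b rule: linorder_cases) auto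
  qed
  moreover have "inj_on ?g J" by (auto simp: inj_on_def)
  ultimately have "card {x \<in> positions (e + 2) (Ab_plus e rho lam N). w \<le> x} = card I + card J"
    by (simp add: card_Un_disjoint card_image)
  then show ?thesis by (simp add: I_def J_def)
qed

text \<open>In the two counts that follow, the second summand is the contribution of the new runner. For a nonempty
partition it vanishes when \<open>z \<ge> rho\<close>; when \<open>z < rho\<close>, it is the growth of the row index of the nodes
on the diagonal of \<open>z\<close>, or one less for the boxes inserted above them. The bound by \<open>N\<close> ensures
that the truncation of the abacus at level \<open>N\<close> is not seen.\<close>

lemma card_positions_above_old:
  assumes "N * m < z"
  shows "card {x \<in> positions (e + 2) (Ab_plus e rho lam N). spread m (z - 1) + 1 \<le> x} =
    beads_from z + nat (N0 e rho lam + int (k_num e rho lam) - (z - 1) div m)"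
proof -
  have "N \<le> (z - 1) div m" using int_div_less_iff[of m "z - 1" N] assms by (simp add: mult.commute)
  moreover have "spread m (z - 1) + 1 \<le> spread m y \<longleftrightarrow> z \<le> y" for y
    using spread_less_iff[of m "z - 1" y] by linarith
  moreover have "spread m (z - 1) + 1 \<le> j * (m + 1) + m \<longleftrightarrow> (z - 1) div m \<le> j" for j
    using spread_less_new_runner_iff[of m "z - 1" j] by linarith
  moreover have "{i. 1 \<le> i \<and> N * m \<le> beta rho lam i \<and> z \<le> beta rho lam i} = {i. 1 \<le> i \<and> z \<le> beta rho lam i}"
    using assms by auto
  moreover have "{j. N \<le> j \<and> j < K \<and> (z - 1) div m \<le> j} = {(z - 1) div m..<K}" for K
    using calculation(1) by auto
  ultimately show ?thesis unfolding card_positions_ge by (simp add: beads_from_def)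
qed

lemma card_positions_above_new:
  assumes "N * m \<le> z" "m dvd z"
  shows "card {x \<in> positions (e + 2) (Ab_plus e rho lam N). spread m z \<le> x} =
    beads_from z + nat (N0 e rho lam + int (k_num e rho lam) - z div m)"
proof -
  have "N \<le> z div m" using int_div_less_iff[of m z N] assms by (simp add: mult.commute not_less[symmetric])
  moreover have "spread m z \<le> j * (m + 1) + m \<longleftrightarrow> z div m \<le> j" for j
    using spread_less_new_runner_iff[of m z j] spread_neq_new_runner[of m z j] by linarith
  moreover have "{i. 1 \<le> i \<and> N * m \<le> beta rho lam i \<and> z \<le> beta rho lam i} = {i. 1 \<le> i \<and> z \<le> beta rho lam i}"
    using assms by auto
  moreover have "{j. N \<le> j \<and> j < K \<and> z div m \<le> j} = {z div m..<K}" for K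
    using calculation(1) by auto
  ultimately show ?thesis unfolding card_positions_ge
    by (simp add: beads_from_def spread_le_iff)
qed

lemma card_positions:
  assumes "N * m \<le> int rho - int (num_parts lam)" "N \<le> N0 e rho lam + int (k_num e rho lam)"
  shows "int (card (positions (e + 2) (Ab_plus e rho lam N))) =
    int rho + N0 e rho lam + int (k_num e rho lam) - N * (m + 1)"
proof -
  let ?P = "positions (e + 2) (Ab_plus e rho lam N)"
  have z: "spread m (N * m) = N * (m + 1)" by (rule spread_multiple) simp
  have "{x \<in> ?P. spread m (N * m) \<le> x} = ?P"
  proof -
    have "N * (m + 1) \<le> j * (m + 1) + m" if "N \<le> j" for j
      using mult_right_mono[OF that, of "m + 1"] by linarith
    then show ?thesis unfolding positions_Ab_plus using z spread_le_iff[of m "N * m"] by auto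
  qed
  then have "int (card ?P) = int (beads_from (N * m)) + (N0 e rho lam + int (k_num e rho lam) - N)"
    using card_positions_above_new[of N "N * m"] assms(2) by simp
  then show ?thesis using beads_from_low[OF assms(1)] by (simp add: algebra_simps)
qed

text \<open>The number of parts cancels: the top of the new runner depends only on the charge. A position
\<open>j * (m + 1) + m\<close> of the new runner is below \<open>charge_plus\<close> iff \<open>j < (rho - 1) div m\<close>, so the
new runner is filled exactly up to the new charge.\<close>

lemma new_runner_height:
  assumes "num_parts lam \<ge> 1"
  shows "N0 e rho lam + int (k_num e rho lam) = (int rho - 1) div m"
  using N0_eq k_num_eq[OF assms] by simp


section \<open>Comparison of the two constructions\<close>

lemma plus_boxesE:
  assumes "(R, C) \<in> plus_boxes e rho lam"
  obtains (moved) r c where "(r, c) \<in> nodes lam" "(R, C) = move e rho lam (r, c)"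
  | (right) r c where "(r, c) \<in> nodes lam" "r \<le> c" "m dvd int rho + int c - int r"
      "(R, C) = right_of (move e rho lam (r, c))"
  | (above) r c where "(r, c) \<in> nodes lam" "c < r" "m dvd int rho + int c - int r"
      "(R, C) = above (move e rho lam (r, c))"
  using assms unfolding plus_boxes_def by (auto simp: zero_nodes_0_iff zero_nodes_1_iff)

text \<open>For a node \<open>(r, c)\<close> there are at least \<open>r\<close> old beads from its diagonal onwards. When \<open>c < r\<close>, the
row index of the moved node exceeds \<open>r\<close> by the number of new beads that join this count. The box
inserted above a 0-node has a row index smaller by 1, and one bead of the new runner, the one just before
\<open>spread m z\<close>, is lost.\<close>

lemma plus_box_imp_bead_count:
  assumes box: "(R, C) \<in> plus_boxes e rho lam"
    and N: "N * m \<le> int rho - int (num_parts lam)"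
  shows "1 \<le> R \<and> 1 \<le> C \<and>
    R \<le> card {x \<in> positions (e + 2) (Ab_plus e rho lam N). charge_plus + int C - int R \<le> x}"
proof -
  define P where "P = positions (e + 2) (Ab_plus e rho lam N)"
  have node: "1 \<le> r" "1 \<le> c" "r \<le> beads_from (int rho + int c - int r)" "1 \<le> num_parts lam"
    "N * m < int rho + int c - int r" if "(r, c) \<in> nodes lam" for r c
  proof -
    show rc: "1 \<le> r" "1 \<le> c" using that by (auto simp: nodes_def)
    show "r \<le> beads_from (int rho + int c - int r)" using that node_iff_beads_from[OF rc] by simp
    have "lam r > 0" using that by (auto simp: nodes_def)
    then have "r \<le> num_parts lam" using lam_pos_iff[OF rc(1)] by simp
    then show "1 \<le> num_parts lam" "N * m < int rho + int c - int r" using rc N by auto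
  qed
  have old: "card {x \<in> P. spread m (int rho + int c - int r - 1) + 1 \<le> x} =
      beads_from (int rho + int c - int r) +
        nat ((int rho - 1) div m - (int rho + int c - int r - 1) div m)"
    if "(r, c) \<in> nodes lam" for r c
    unfolding P_def using card_positions_above_old[OF node(5)[OF that]]
      new_runner_height[OF node(4)[OF that]] by simp
  have new: "card {x \<in> P. spread m (int rho + int c - int r - 1) + 2 \<le> x} =
      beads_from (int rho + int c - int r) +
        nat ((int rho - 1) div m - (int rho + int c - int r - 1) div m - 1)"
    if "(r, c) \<in> nodes lam" "m dvd int rho + int c - int r" for r c
    using card_positions_above_new[of N, OF _ that(2)] node(5)[OF that(1)]
      new_runner_height[OF node(4)[OF that(1)]] spread_pred_multiple[OF _ that(2)]
    by (simp add: P_def)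
  have "1 \<le> R \<and> 1 \<le> C \<and> R \<le> card {x \<in> P. charge_plus + int C - int R \<le> x}"
    using box
  proof (cases rule: plus_boxesE)
    case (moved r c)
    note node = node[OF moved(1)] and old = old[OF moved(1)]
    show ?thesis
    proof (cases "r \<le> c")
      case True
      with moved(1) obtain C' where "move e rho lam (r, c) = (r, C')" "c \<le> C'"
        "charge_plus + int C' - int r = spread m (int rho + int c - int r - 1) + 1"
        by (rule move_upper)
      then show ?thesis using moved node old by simp
    next
      case False
      then have "c < r" by simp
      with moved(1) obtain R' where R': "move e rho lam (r, c) = (R', c)" "r \<le> R'"
        "charge_plus + int c - int R' = spread m (int rho + int c - int r - 1) + 1"
        by (rule move_lower)
      then have "int R' = int r + ((int rho - 1) div m - (int rho + int c - int r - 1) div m)"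
        by (simp add: charge_plus_def spread_def)
      then show ?thesis using R' moved node old by simp
    qed
  next
    case (right r c)
    note node = node[OF right(1)] and new = new[OF right(1,3)]
    obtain C' where "move e rho lam (r, c) = (r, C')" "c \<le> C'"
        "charge_plus + int C' - int r = spread m (int rho + int c - int r - 1) + 1"
      using right(1,2) by (rule move_upper)
    moreover have "charge_plus + int C - int R = spread m (int rho + int c - int r - 1) + 2"
      using right(4) calculation by simp
    ultimately have "R \<le> card {x \<in> P. charge_plus + int C - int R \<le> x}"
      using right(4) node new by (simp only: prod.inject right_of.simps)
    then show ?thesis using right(4) node \<open>move e rho lam (r, c) = (r, C')\<close> by simp
  next
    case (above r c)
    note node = node[OF above(1)] and new = new[OF above(1,3)]
    obtain R' where R': "move e rho lam (r, c) = (R', c)" "r \<le> R'"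
        "charge_plus + int c - int R' = spread m (int rho + int c - int r - 1) + 1"
      using above(1,2) by (rule move_lower)
    have RC: "R = R' - 1" "C = c" using above(4) R' by auto
    have "2 \<le> R'" using above(2) node R'(2) by linarith
    then have R: "int R = int R' - 1" unfolding RC by simp
    have "int R' = int r + ((int rho - 1) div m - (int rho + int c - int r - 1) div m)"
      using R'(3) by (simp add: charge_plus_def spread_def)
    then have "int R \<le> int (beads_from (int rho + int c - int r) +
        nat ((int rho - 1) div m - (int rho + int c - int r - 1) div m - 1))"
      using R node(3) by linarith
    moreover have "charge_plus + int C - int R = spread m (int rho + int c - int r - 1) + 2"
      using R R'(3) RC by simp
    ultimately have "R \<le> card {x \<in> P. charge_plus + int C - int R \<le> x}"
      using new by (simp only: of_nat_le_iff)
    moreover have "1 \<le> R" using R \<open>2 \<le> R'\<close> by linarith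
    ultimately show ?thesis using RC node by simp
  qed
  then show ?thesis by (simp add: P_def)
qed

text \<open>The diagonal of \<open>(R, C)\<close> comes from a diagonal of \<open>lam\<close>, by \<open>position_cases\<close>. Above the cut
the required node is in row \<open>R\<close> of that diagonal, below the cut in column \<open>C\<close>; the bead count
shows that it belongs to \<open>lam\<close>.\<close>

lemma bead_count_imp_plus_box:
  assumes RC: "1 \<le> R" "1 \<le> C" and t: "1 \<le> num_parts lam"
    and N: "N < 0" "N * m \<le> int rho - int (num_parts lam)"
    and R: "R \<le> card {x \<in> positions (e + 2) (Ab_plus e rho lam N). charge_plus + int C - int R \<le> x}"
  shows "(R, C) \<in> plus_boxes e rho lam"
proof -
  let ?P = "positions (e + 2) (Ab_plus e rho lam N)"
  define w where "w = charge_plus + int C - int R"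
  have height: "N0 e rho lam + int (k_num e rho lam) = (int rho - 1) div m"
    by (rule new_runner_height[OF t])
  have "-1 \<le> (int rho - 1) div m" using zdiv_mono1[of "-1" "int rho - 1" m] by (simp add: div_eq_minus1)
  then have "int (card ?P) = charge_plus - N * (m + 1)"
    using card_positions[OF N(2)] N(1) height by (simp add: charge_plus_def)
  moreover have "R \<le> card ?P"
    using R card_mono[OF finite_positions_Ab_plus, of "{x \<in> ?P. charge_plus + int C - int R \<le> x}" N] by simp
  \<comment> \<open>Otherwise even all beads of the truncated abacus would be too few, as there are
    \<open>charge_plus - N * (m + 1) \<le> R - C\<close> of them.\<close>
  ultimately have w: "N * (m + 1) < w" using RC unfolding w_def by linarith
  have top: "spread m (N * m) = N * (m + 1)" by (rule spread_multiple) simp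
  have charge: "charge_plus = spread m (int rho - 1) + 1" by (simp add: charge_plus_def spread_def)
  have "0 < m" by simp
  then show ?thesis
  proof (cases rule: position_cases[of _ w])
    case (old z)
    have "spread m (N * m - 1) < spread m (z - 1)"
      using w old top spread_pred_multiple[of m "N * m"] by simp
    then have z: "N * m < z" using spread_less_iff[of m "N * m - 1" "z - 1"] by simp
    have bound: "R \<le> beads_from z + nat ((int rho - 1) div m - (z - 1) div m)"
      using R card_positions_above_old[OF z] old height by (simp add: w_def)
    show ?thesis
    proof (cases "int rho \<le> z")
      case True
      define c where "c = nat (z - int rho + int R)"
      have c: "int rho + int c - int R = z" "R \<le> c" using True by (auto simp: c_def)
      have "(int rho - 1) div m \<le> (z - 1) div m" using True by (intro zdiv_mono1) auto
      then have "(R, c) \<in> nodes lam" using node_iff_beads_from[of R c] c RC bound by simp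
      moreover from this c(2) obtain C' where "move e rho lam (R, c) = (R, C')"
        "charge_plus + int C' - int R = spread m (int rho + int c - int R - 1) + 1"
        by (rule move_upper)
      then have "move e rho lam (R, c) = (R, C)" using c old by (simp add: w_def)
      ultimately show ?thesis unfolding plus_boxes_def by (metis UnI1 image_eqI)
    next
      case False
      define r where "r = nat (int rho + int C - z)"
      have r: "int rho + int C - int r = z" "C < r" using False by (auto simp: r_def)
      have "(z - 1) div m \<le> (int rho - 1) div m" using False by (intro zdiv_mono1) auto
      moreover have "int R = int r + ((int rho - 1) div m - (z - 1) div m)"
        using old r by (simp add: w_def charge_plus_def spread_def)
      ultimately have "r \<le> beads_from z" using bound by linarith
      then have "(r, C) \<in> nodes lam" using node_iff_beads_from[of r C] r RC by simp
      moreover from this r(2) obtain R' where "move e rho lam (r, C) = (R', C)"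
        "charge_plus + int C - int R' = spread m (int rho + int C - int r - 1) + 1"
        by (rule move_lower)
      then have "move e rho lam (r, C) = (R, C)" using r old by (simp add: w_def)
      ultimately show ?thesis unfolding plus_boxes_def by (metis UnI1 image_eqI)
    qed
  next
    case (new z)
    note pred = spread_pred_multiple[of m z, OF _ new(1)]
    have z: "N * m < z" using w new(2) top spread_less_iff[of m "N * m" z] by simp
    have bound: "R \<le> beads_from z + nat ((int rho - 1) div m - (z - 1) div m - 1)"
      using R card_positions_above_new[of N z] new z height pred by (simp add: w_def)
    show ?thesis
    proof (cases "int rho \<le> z")
      case True
      define c where "c = nat (z - int rho + int R)"
      have c: "int rho + int c - int R = z" "R \<le> c" using True by (auto simp: c_def)
      have "(int rho - 1) div m \<le> (z - 1) div m" using True by (intro zdiv_mono1) auto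
      then have node: "(R, c) \<in> nodes lam" using node_iff_beads_from[of R c] c RC bound by simp
      from this c(2) obtain C' where "move e rho lam (R, c) = (R, C')"
        "charge_plus + int C' - int R = spread m (int rho + int c - int R - 1) + 1"
        by (rule move_upper)
      moreover have "C = C' + 1" using calculation c new pred by (simp add: w_def)
      ultimately have "(R, C) = right_of (move e rho lam (R, c))" by simp
      moreover have "(R, c) \<in> zero_nodes e rho lam 0"
        using node c new(1) by (simp add: zero_nodes_0_iff)
      ultimately show ?thesis unfolding plus_boxes_def by blast
    next
      case False
      define r where "r = nat (int rho + int C - z)"
      have r: "int rho + int C - int r = z" "C < r" using False by (auto simp: r_def)
      have "z div m \<le> (int rho - 1) div m" using False by (intro zdiv_mono1) auto
      moreover have R_eq: "int R = int r + ((int rho - 1) div m - (z - 1) div m) - 1"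
        using new pred r by (simp add: w_def charge_plus_def spread_def)
      ultimately have "r \<le> beads_from z" using bound pred by linarith
      then have node: "(r, C) \<in> nodes lam" using node_iff_beads_from[of r C] r RC by simp
      from this r(2) obtain R' where "move e rho lam (r, C) = (R', C)"
        "charge_plus + int C - int R' = spread m (int rho + int C - int r - 1) + 1"
        by (rule move_lower)
      moreover have "R' = R + 1" using calculation r new pred by (simp add: w_def)
      ultimately have "(R, C) = above (move e rho lam (r, C))" by simp
      moreover have "(r, C) \<in> zero_nodes e rho lam 1"
        using node r new(1) by (simp add: zero_nodes_1_iff)
      ultimately show ?thesis unfolding plus_boxes_def by blast
    qed
  qed
qed

text \<open>The empty partition is separate, because its new runner is filled below level 0 even if \<open>rho = 0\<close>,
one level more than in \<open>new_runner_height\<close>. All beads are below the charge, and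
this alone leaves no room for a box.\<close>

lemma card_positions_empty:
  assumes "num_parts lam = 0" "1 \<le> R" "1 \<le> C"
  shows "card {x \<in> positions (e + 2) (Ab_plus e rho lam N). int rho + int C - int R \<le> x} < R"
proof -
  have lam: "lam i = 0" if "1 \<le> i" for i using lam_pos_iff[OF that] assms(1) that by simp
  have N0: "N0 e rho lam = 0" using N0_eq rho_le assms(1) by (simp add: div_pos_pos_trivial)
  have k: "k_num e rho lam = 0" using lam by (simp add: k_num_def)
  have "spread m (beta rho lam i) < int rho" if "1 \<le> i" for i
  proof -
    have "beta rho lam i \<le> int rho - 1" using lam[OF that] that by (simp add: beta_def)
    moreover have "(int rho - 1) div m \<le> 0" using zdiv_mono1[of "int rho - 1" "int rho" m] rho_le
      by (simp add: div_pos_pos_trivial)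
    ultimately show ?thesis using spread_le_iff[of m "beta rho lam i" "int rho - 1"]
      by (simp add: spread_def)
  qed
  moreover have "j * (m + 1) + m < int rho" if "j < 0" for j
    using mult_right_mono[of j "-1" "m + 1"] that by simp
  ultimately have "{x \<in> positions (e + 2) (Ab_plus e rho lam N). int rho + int C - int R \<le> x}
    \<subseteq> {int rho + int C - int R..<int rho}"
    unfolding positions_Ab_plus using N0 k by auto
  from card_mono[OF _ this] show ?thesis using assms(2,3) by simp
qed

lemma plus_boxes_iff:
  assumes "N < 0" "N * m \<le> int rho - int (num_parts lam)" "1 \<le> R" "1 \<le> C"
  shows "(R, C) \<in> plus_boxes e rho lam \<longleftrightarrow> C \<le> abacus_plus e rho lam N R"
proof -
  define K where "K = N0 e rho lam + int (k_num e rho lam)"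
  let ?P = "positions (e + 2) (Ab_plus e rho lam N)"
  have K: "K = (if num_parts lam = 0 then 0 else (int rho - 1) div m)"
    using new_runner_height rho_le N0_eq lam_pos_iff
    by (auto simp: K_def k_num_def div_pos_pos_trivial)
  have "-1 \<le> (int rho - 1) div m" using zdiv_mono1[of "-1" "int rho - 1" m] by (simp add: div_eq_minus1)
  then have "N \<le> K" using assms(1) K by auto
  then have "abacus_charge (e + 2) N (Ab_plus e rho lam N) = int rho + K"
    using card_positions[OF assms(2)] by (simp add: abacus_charge_def K_def algebra_simps)
  then have iff: "C \<le> abacus_plus e rho lam N R \<longleftrightarrow> R \<le> card {x \<in> ?P. int rho + K + int C - int R \<le> x}"
    unfolding abacus_plus_def
    using le_abacus_partition_iff[OF finite_positions_Ab_plus assms(3,4), of N N] by simp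
  show ?thesis
  proof (cases "num_parts lam = 0")
    case True
    then have "nodes lam = {}" using lam_pos_iff by (auto simp: nodes_def)
    then have "plus_boxes e rho lam = {}"
      by (auto simp: plus_boxes_def zero_nodes_0_iff zero_nodes_1_iff)
    then show ?thesis using iff card_positions_empty[OF True assms(3,4)] K True by (simp add: not_le)
  next
    case False
    then have "int rho + K = charge_plus" using K by (simp add: charge_plus_def)
    then show ?thesis
      using iff plus_box_imp_bead_count[OF _ assms(2)] bead_count_imp_plus_box[OF assms(3,4) _ assms(1,2)] False by auto
  qed
qed

lemma abacus_plus_eq_box_plus:
  assumes N: "N < 0" "N * m \<le> int rho - int (num_parts lam)"
  shows "abacus_plus e rho lam N = box_plus e rho lam"
proof
  fix R
  have pos: "1 \<le> R \<and> 1 \<le> C" if "(R, C) \<in> plus_boxes e rho lam" for C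
    using plus_box_imp_bead_count[OF that N(2)] by blast
  show "abacus_plus e rho lam N R = box_plus e rho lam R"
  proof (cases "R = 0")
    case True
    then have "{C. (R, C) \<in> plus_boxes e rho lam} = {}" using pos by auto
    then show ?thesis using True
      by (simp add: abacus_plus_def abacus_partition_def box_plus_def row_lengths_def)
  next
    case False
    then have "C \<in> {C. (R, C) \<in> plus_boxes e rho lam} \<longleftrightarrow> C \<in> {1..abacus_plus e rho lam N R}" for C
      using plus_boxes_iff[OF N, of R C] pos[of C] by (cases "1 \<le> C") auto
    then have "{C. (R, C) \<in> plus_boxes e rho lam} = {1..abacus_plus e rho lam N R}" by blast
    then show ?thesis by (simp add: box_plus_def row_lengths_def)
  qed
qed

end

theorem theorem5p3p18:
  fixes e n rho :: nat and lam :: "nat \<Rightarrow> nat" and N :: int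
  assumes "e \<ge> 1"
    and "is_partition_of lam n"
    and "rho \<in> {0..e}"
    and "N < 0"
    and "int rho - N * int (e + 1) \<ge> int (num_parts lam)"
  shows "abacus_plus e rho lam N = box_plus e rho lam"
proof -
  interpret charged_partition e rho lam
    using assms by unfold_locales (auto simp: is_partition_of_def)
  show ?thesis by (rule abacus_plus_eq_box_plus) (use assms in \<open>auto simp: algebra_simps\<close>)
qed

end
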